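(* Let $\beta\in B_m$ and let $\Gamma$ be an e-graph with $m$ edges. Then the Hurwitz action satisfies $$(\Gamma\beta)^{*}=\Gamma^{*}\beta^{*},$$ where on graphs $*$ denotes the mind-body dual and on $B_m$ it denotes the automorphism with $\sigma_i\mapsto\sigma_i^{-1}$ for all $i$.
   Context: An e-graph with $m$ edges is a finite loopless graph (multiple edges allowed) with vertex set $V$ and $m$ edges labeled bijectively by $[m]$. E-graphs with vertex set $V$ correspond bijectively to factorizations $\rho=(\tau_1,\dots,\tau_m)$, i.e. sequences of transpositions in $\mathcal{S}_V$: the edge labeled $i$ joins the two points moved by $\tau_i$. $B_m$ is the braid group with generators $\sigma_1,\dots,\sigma_{m-1}$ and relations $\sigma_i\sigma_j=\sigma_j\sigma_i$ ($|i-j|>1$), $\sigma_i\sigma_{i+1}\sigma_i=\sigma_{i+1}\sigma_i\sigma_{i+1}$. The Hurwitz action is the right action of $B_m$ on factorizations of length $m$ given by $(\rho\sigma_i)_k=\tau_k$ for $k\ne i,i+1$, $(\rho\sigma_i)_i=\tau_i\tau_{i+1}\tau_i^{-1}$, $(\rho\sigma_i)_{i+1}=\tau_i$ (permutations multiplied from left to right); it is transferred to e-graphs by the bijection above. Mind-body dual: for a vertex $v$ the minimally increasing greedy trail (migt) $\overrightarrow{v}$ starts at $v$ along the smallest-labeled edge at $v$; after arriving at a vertex $w$ along an edge $e$ it continues with the smallest-labeled edge at $w$ larger than $e$, and stops if there is none. If $v$ is isolated, $\overrightarrow{v}$ is the trivial trail. Every edge belongs to exactly two migts. $\Gamma^*$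 has vertices $v^*=\overrightarrow{v}$, identified with $v\in V$, and for each $i$ an edge labeled $i$ joining the two migts that contain the edge of $\Gamma$ labeled $i$. *)

theory Defs
  imports "HOL-Algebra.Group" "HOL-Combinatorics.Permutations"
begin

section \<open>The braid group\<close>

datatype letter = Gen nat | GenInv nat

fun flip :: "letter \<Rightarrow> letter" where
  "flip (Gen i) = GenInv i"
| "flip (GenInv i) = Gen i"

definition letters :: "nat \<Rightarrow> letter set" where
  "letters m = Gen ` {1..<m} \<union> GenInv ` {1..<m}"

definition words :: "nat \<Rightarrow> letter list set" where
  "words m = lists (letters m)"

text \<open>Two words over the signed generators are related iff they represent the same element of
  the group presented by the generators \<open>\<sigma>\<^sub>1, \<dots>, \<sigma>\<^sub>m\<^sub>-\<^sub>1\<close> and the braid relations.\<close>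

inductive braid_equiv :: "nat \<Rightarrow> letter list \<Rightarrow> letter list \<Rightarrow> bool" for m where
  word_refl: "w \<in> words m \<Longrightarrow> braid_equiv m w w"
| word_sym: "braid_equiv m u v \<Longrightarrow> braid_equiv m v u"
| word_trans: "braid_equiv m u v \<Longrightarrow> braid_equiv m v w \<Longrightarrow> braid_equiv m u w"
| word_append: "braid_equiv m u u' \<Longrightarrow> braid_equiv m v v' \<Longrightarrow> braid_equiv m (u @ v) (u' @ v')"
| word_cancel: "x \<in> letters m \<Longrightarrow> braid_equiv m [x, flip x] []"
| word_far: "i \<in> {1..<m} \<Longrightarrow> j \<in> {1..<m} \<Longrightarrow> \<bar>int i - int j\<bar> > 1 \<Longrightarrow>
    braid_equiv m [Gen i, Gen j] [Gen j, Gen i]"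
| word_near: "i \<in> {1..<m} \<Longrightarrow> i + 1 \<in> {1..<m} \<Longrightarrow>
    braid_equiv m [Gen i, Gen (i + 1), Gen i] [Gen (i + 1), Gen i, Gen (i + 1)]"

definition braid_rel :: "nat \<Rightarrow> (letter list \<times> letter list) set" where
  "braid_rel m = {(u, v). braid_equiv m u v}"

definition braid_class :: "nat \<Rightarrow> letter list \<Rightarrow> letter list set" where
  "braid_class m w = braid_rel m `` {w}"

definition braid_group :: "nat \<Rightarrow> letter list set monoid" where
  "braid_group m =
    \<lparr>carrier = words m // braid_rel m,
     monoid.mult = (\<lambda>X Y. \<Union>x\<in>X. \<Union>y\<in>Y. braid_class m (x @ y)),
     one = braid_class m []\<rparr>"

definition sigma :: "nat \<Rightarrow> nat \<Rightarrow> letter list set" where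
  "sigma m i = braid_class m [Gen i]"

definition braid_star :: "nat \<Rightarrow> letter list set \<Rightarrow> letter list set" where
  "braid_star m \<beta> = (\<Union>w\<in>\<beta>. braid_class m (map flip w))"

lemma flip_flip [simp]: "flip (flip x) = x"
  by (cases x) auto

lemma flip_letters [simp]: "flip x \<in> letters m \<longleftrightarrow> x \<in> letters m"
  by (cases x) (auto simp: letters_def)

lemma Gen_letters [simp]: "Gen i \<in> letters m \<longleftrightarrow> i \<in> {1..<m}"
  by (auto simp: letters_def)

lemma GenInv_letters [simp]: "GenInv i \<in> letters m \<longleftrightarrow> i \<in> {1..<m}"
  by (auto simp: letters_def)

lemma words_simps [simp]:
  "[] \<in> words m"
  "x # w \<in> words m \<longleftrightarrow> x \<in> letters m \<and> w \<in> words m"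
  "u @ v \<in> words m \<longleftrightarrow> u \<in> words m \<and> v \<in> words m"
  "rev w \<in> words m \<longleftrightarrow> w \<in> words m"
  by (auto simp: words_def)

lemma map_flip_words [simp]: "map flip w \<in> words m \<longleftrightarrow> w \<in> words m"
  by (induction w) auto

lemma braid_equiv_words:
  "braid_equiv m u v \<Longrightarrow> u \<in> words m \<and> v \<in> words m"
  by (induction rule: braid_equiv.induct) auto

lemma equiv_braid_rel: "equiv (words m) (braid_rel m)"
proof (rule equivI)
  show "braid_rel m \<subseteq> words m \<times> words m"
    using braid_equiv_words by (auto simp: braid_rel_def)
  show "refl_on (words m) (braid_rel m)"
    by (simp add: refl_on_def braid_rel_def braid_equiv.word_refl)
  show "sym (braid_rel m)"
    by (simp add: sym_def braid_rel_def braid_equiv.word_sym)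
  show "trans (braid_rel m)"
    unfolding trans_def braid_rel_def using braid_equiv.word_trans by blast
qed

lemma braid_class_eq_iff:
  "u \<in> words m \<Longrightarrow> v \<in> words m \<Longrightarrow>
    braid_class m u = braid_class m v \<longleftrightarrow> braid_equiv m u v"
  using eq_equiv_class_iff[OF equiv_braid_rel, of u m v]
  by (simp add: braid_class_def braid_rel_def)

lemma braid_classI: "braid_equiv m u v \<Longrightarrow> braid_class m u = braid_class m v"
  using braid_class_eq_iff braid_equiv_words by blast

lemma mem_braid_class: "v \<in> braid_class m u \<longleftrightarrow> braid_equiv m u v"
  by (simp add: braid_class_def braid_rel_def)

lemma braid_class_carrier:
  "w \<in> words m \<Longrightarrow> braid_class m w \<in> carrier (braid_group m)"
  by (simp add: braid_group_def braid_class_def quotientI)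

lemma braid_carrierE:
  assumes "\<beta> \<in> carrier (braid_group m)"
  obtains w where "w \<in> words m" "\<beta> = braid_class m w"
  using assms by (auto simp: braid_group_def braid_class_def elim!: quotientE)

lemma braid_class_mem:
  assumes "\<beta> \<in> carrier (braid_group m)" "w \<in> \<beta>"
  shows "w \<in> words m" "\<beta> = braid_class m w"
proof -
  obtain u where "\<beta> = braid_class m u" using assms(1) by (rule braid_carrierE)
  with assms(2) have "braid_equiv m u w" by (simp add: mem_braid_class)
  with \<open>\<beta> = braid_class m u\<close> show "w \<in> words m" "\<beta> = braid_class m w"
    using braid_equiv_words braid_classI by blast+
qed

lemma braid_mult:
  assumes "u \<in> words m" "v \<in> words m"
  shows "braid_class m u \<otimes>\<^bsub>braid_group m\<^esub> braid_class m v = braid_class m (u @ v)"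
proof -
  have "braid_class m (x @ y) = braid_class m (u @ v)"
    if "x \<in> braid_class m u" "y \<in> braid_class m v" for x y
    using that unfolding mem_braid_class
    by (rule braid_classI[OF braid_equiv.word_append, THEN sym])
  then have "(\<Union>x\<in>braid_class m u. \<Union>y\<in>braid_class m v. braid_class m (x @ y)) =
      (\<Union>x\<in>braid_class m u. \<Union>y\<in>braid_class m v. braid_class m (u @ v))"
    by (intro SUP_cong refl)
  moreover have "u \<in> braid_class m u" "v \<in> braid_class m v"
    using assms by (simp_all add: mem_braid_class braid_equiv.word_refl)
  ultimately show ?thesis
    by (auto simp: braid_group_def)
qed

abbreviation inverse_word :: "letter list \<Rightarrow> letter list" where
  "inverse_word w \<equiv> rev (map flip w)"

lemma braid_equiv_append_cong:
  assumes "u \<in> words m" "v \<in> words m" "braid_equiv m x y"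
  shows "braid_equiv m (u @ x @ v) (u @ y @ v)"
  by (rule braid_equiv.word_append[OF braid_equiv.word_refl[OF assms(1)]
        braid_equiv.word_append[OF assms(3) braid_equiv.word_refl[OF assms(2)]]])

lemma inverse_word_left: "w \<in> words m \<Longrightarrow> braid_equiv m (inverse_word w @ w) []"
proof (induction w)
  case Nil
  then show ?case by (auto intro: braid_equiv.word_refl)
next
  case (Cons x w)
  then have w: "inverse_word w \<in> words m" "w \<in> words m" "flip x \<in> letters m" by simp_all
  from braid_equiv_append_cong[OF w(1,2) braid_equiv.word_cancel[OF w(3)]]
  have "braid_equiv m (inverse_word (x # w) @ x # w) (inverse_word w @ w)" by simp
  then show ?case using Cons.IH[OF w(2)] by (rule braid_equiv.word_trans)
qed

lemma inverse_word_right: "w \<in> words m \<Longrightarrow> braid_equiv m (w @ inverse_word w) []"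
  using inverse_word_left[of "inverse_word w" m]
  by (simp add: rev_map[symmetric] o_def)

lemma braid_equiv_inverse_word:
  assumes "braid_equiv m u v"
  shows "braid_equiv m (inverse_word u) (inverse_word v)"
proof -
  have uv: "u \<in> words m" "v \<in> words m"
    using assms braid_equiv_words by auto
  then have iuv: "inverse_word u \<in> words m" "inverse_word v \<in> words m"
    by auto
  have 1: "braid_equiv m (inverse_word u @ v @ inverse_word v) (inverse_word u)"
    using braid_equiv.word_append[OF braid_equiv.word_refl[OF iuv(1)] inverse_word_right[OF uv(2)]] by simp
  have 2: "braid_equiv m (inverse_word u @ u @ inverse_word v) (inverse_word u @ v @ inverse_word v)"
    using braid_equiv_append_cong[OF iuv assms] .
  have 3: "braid_equiv m (inverse_word u @ u @ inverse_word v) (inverse_word v)"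
    using braid_equiv.word_append[OF inverse_word_left[OF uv(1)] braid_equiv.word_refl[OF iuv(2)]] by simp
  show ?thesis
    by (rule braid_equiv.word_trans[OF braid_equiv.word_sym[OF 1] braid_equiv.word_trans[OF braid_equiv.word_sym[OF 2] 3]])
qed

lemma braid_equiv_map_flip:
  "braid_equiv m u v \<Longrightarrow> braid_equiv m (map flip u) (map flip v)"
proof (induction rule: braid_equiv.induct)
  case (word_far i j)
  then show ?case
    using braid_equiv_inverse_word[OF braid_equiv.word_far[of j m i]] by (simp add: abs_minus_commute)
next
  case (word_near i)
  then show ?case
    using braid_equiv_inverse_word[OF braid_equiv.word_near[of i m]] by simp
next
  case (word_cancel x)
  then show ?case using braid_equiv.word_cancel[of "flip x" m] by simp
next
  case (word_sym u v)
  show ?case by (rule braid_equiv.word_sym[OF word_sym.IH])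
next
  case (word_trans u v w)
  show ?case by (rule braid_equiv.word_trans[OF word_trans.IH])
next
  case (word_append u u' v v')
  then show ?case by (simp add: braid_equiv.word_append)
next
  case (word_refl w)
  then show ?case by (intro braid_equiv.word_refl) simp
qed

lemma braid_one: "\<one>\<^bsub>braid_group m\<^esub> = braid_class m []"
  by (simp add: braid_group_def)

lemma group_braid_group: "group (braid_group m)"
proof (rule groupI)
  fix x y z
  assume x: "x \<in> carrier (braid_group m)" and y: "y \<in> carrier (braid_group m)"
  from x y show "x \<otimes>\<^bsub>braid_group m\<^esub> y \<in> carrier (braid_group m)"
    by (auto elim!: braid_carrierE simp: braid_mult intro!: braid_class_carrier)
  assume z: "z \<in> carrier (braid_group m)"
  from x y z show "x \<otimes>\<^bsub>braid_group m\<^esub> y \<otimes>\<^bsub>braid_group m\<^esub> z =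
      x \<otimes>\<^bsub>braid_group m\<^esub> (y \<otimes>\<^bsub>braid_group m\<^esub> z)"
    by (auto elim!: braid_carrierE simp: braid_mult)
next
  show "\<one>\<^bsub>braid_group m\<^esub> \<in> carrier (braid_group m)"
    by (auto simp: braid_one intro!: braid_class_carrier)
next
  fix x assume x: "x \<in> carrier (braid_group m)"
  then show "\<one>\<^bsub>braid_group m\<^esub> \<otimes>\<^bsub>braid_group m\<^esub> x = x"
    by (auto elim!: braid_carrierE simp: braid_mult braid_one)
  from x obtain w where w: "w \<in> words m" "x = braid_class m w"
    by (rule braid_carrierE)
  then have "inverse_word w \<in> words m" by auto
  with w show "\<exists>y\<in>carrier (braid_group m). y \<otimes>\<^bsub>braid_group m\<^esub> x = \<one>\<^bsub>braid_group m\<^esub>"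
    by (intro bexI[of _ "braid_class m (inverse_word w)"])
      (auto simp: braid_mult braid_one
        intro!: braid_classI inverse_word_left braid_class_carrier)
qed

lemma sigma_carrier: "i \<in> {1..<m} \<Longrightarrow> sigma m i \<in> carrier (braid_group m)"
  by (auto simp: sigma_def intro!: braid_class_carrier)

lemma inv_sigma: "i \<in> {1..<m} \<Longrightarrow> inv\<^bsub>braid_group m\<^esub> (sigma m i) = braid_class m [GenInv i]"
  using braid_equiv.word_cancel[of "GenInv i" m]
  by (intro group.inv_equality[OF group_braid_group])
    (auto simp: sigma_def braid_mult braid_one intro!: braid_classI braid_class_carrier)

lemma braid_star_class:
  assumes "w \<in> words m"
  shows "braid_star m (braid_class m w) = braid_class m (map flip w)"
proof -
  have "braid_class m (map flip x) = braid_class m (map flip w)" if "x \<in> braid_class m w" for x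
    using that unfolding mem_braid_class
    by (rule braid_classI[OF braid_equiv_map_flip, THEN sym])
  then have "(\<Union>x\<in>braid_class m w. braid_class m (map flip x)) =
      (\<Union>x\<in>braid_class m w. braid_class m (map flip w))"
    by (intro SUP_cong refl)
  moreover have "w \<in> braid_class m w"
    using assms by (simp add: mem_braid_class braid_equiv.word_refl)
  ultimately show ?thesis
    by (auto simp: braid_star_def)
qed

lemma braid_star_automorphism: "braid_star m \<in> iso (braid_group m) (braid_group m)"
proof -
  have closed: "braid_star m x \<in> carrier (braid_group m)" if "x \<in> carrier (braid_group m)" for x
    using that by (auto elim!: braid_carrierE simp: braid_star_class
        intro!: braid_class_carrier)
  have invol: "braid_star m (braid_star m x) = x" if "x \<in> carrier (braid_group m)" for x
  proof -
    from that obtain w where w: "w \<in> words m" "x = braid_class m w"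
      by (rule braid_carrierE)
    have "map flip w \<in> words m" using w(1) by simp
    with w show ?thesis by (simp add: braid_star_class o_def)
  qed
  have "braid_star m (x \<otimes>\<^bsub>braid_group m\<^esub> y) =
      braid_star m x \<otimes>\<^bsub>braid_group m\<^esub> braid_star m y"
    if "x \<in> carrier (braid_group m)" "y \<in> carrier (braid_group m)" for x y
  proof -
    from that obtain u v where "u \<in> words m" "x = braid_class m u"
      "v \<in> words m" "y = braid_class m v" by (auto elim!: braid_carrierE)
    moreover from this have "map flip u \<in> words m" "map flip v \<in> words m"
      "u @ v \<in> words m" by simp_all
    ultimately show ?thesis
      by (simp add: braid_mult braid_star_class)
  qed
  moreover have "bij_betw (braid_star m) (carrier (braid_group m)) (carrier (braid_group m))"
    by (rule bij_betw_byWitness[where f' = "braid_star m"]) (use closed invol in auto)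
  ultimately show ?thesis using closed by (auto simp: iso_def hom_def)
qed

lemma braid_star_sigma:
  "i \<in> {1..<m} \<Longrightarrow> braid_star m (sigma m i) = inv\<^bsub>braid_group m\<^esub> (sigma m i)"
  by (simp add: inv_sigma, simp add: sigma_def braid_star_class)


section \<open>E-graphs, factorizations and the Hurwitz action\<close>

text \<open>The edge labeled \<open>i\<close> is the two-element set \<open>\<Gamma> i\<close> of its endpoints.\<close>

definition e_graphs :: "'v set \<Rightarrow> nat \<Rightarrow> (nat \<Rightarrow> 'v set) set" where
  "e_graphs V m = {1..m} \<rightarrow>\<^sub>E {e. e \<subseteq> V \<and> card e = 2}"

definition factorizations :: "'v set \<Rightarrow> nat \<Rightarrow> (nat \<Rightarrow> 'v \<Rightarrow> 'v) set" where
  "factorizations V m =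
    {1..m} \<rightarrow>\<^sub>E {\<tau>. \<exists>a\<in>V. \<exists>b\<in>V. a \<noteq> b \<and> \<tau> = transpose a b}"

definition graph_of :: "nat \<Rightarrow> (nat \<Rightarrow> 'v \<Rightarrow> 'v) \<Rightarrow> nat \<Rightarrow> 'v set" where
  "graph_of m \<rho> = (\<lambda>i\<in>{1..m}. {x. \<rho> i x \<noteq> x})"

definition factorization_of :: "'v set \<Rightarrow> nat \<Rightarrow> (nat \<Rightarrow> 'v set) \<Rightarrow> nat \<Rightarrow> 'v \<Rightarrow> 'v" where
  "factorization_of V m = inv_into (factorizations V m) (graph_of m)"

text \<open>Permutations are multiplied from left to right.\<close>

definition perm_mult :: "('v \<Rightarrow> 'v) \<Rightarrow> ('v \<Rightarrow> 'v) \<Rightarrow> 'v \<Rightarrow> 'v" (infixl "\<cdot>" 70) where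
  "\<alpha> \<cdot> \<beta> = \<beta> \<circ> \<alpha>"

abbreviation perm_inv :: "('v \<Rightarrow> 'v) \<Rightarrow> 'v \<Rightarrow> 'v" where
  "perm_inv \<equiv> inv_into UNIV"

text \<open>The second equation is the inverse of the bijection given by the first one;
  the case of \<open>word_cancel\<close> in \<open>word_act_cong\<close> verifies this.\<close>

fun letter_act :: "(nat \<Rightarrow> 'v \<Rightarrow> 'v) \<Rightarrow> letter \<Rightarrow> nat \<Rightarrow> 'v \<Rightarrow> 'v" where
  "letter_act \<rho> (Gen i) = \<rho>(i := \<rho> i \<cdot> \<rho> (i + 1) \<cdot> perm_inv (\<rho> i), i + 1 := \<rho> i)"
| "letter_act \<rho> (GenInv i) =
    \<rho>(i := \<rho> (i + 1), i + 1 := perm_inv (\<rho> (i + 1)) \<cdot> \<rho> i \<cdot> \<rho> (i + 1))"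

text \<open>By \<open>word_act_cong\<close>, the result does not depend on the chosen representative.\<close>

definition hurwitz_fact :: "(nat \<Rightarrow> 'v \<Rightarrow> 'v) \<Rightarrow> letter list set \<Rightarrow> nat \<Rightarrow> 'v \<Rightarrow> 'v" where
  "hurwitz_fact \<rho> \<beta> = foldl letter_act \<rho> (SOME w. w \<in> \<beta>)"

definition hurwitz ::
  "'v set \<Rightarrow> nat \<Rightarrow> (nat \<Rightarrow> 'v set) \<Rightarrow> letter list set \<Rightarrow> nat \<Rightarrow> 'v set" where
  "hurwitz V m \<Gamma> \<beta> = graph_of m (hurwitz_fact (factorization_of V m \<Gamma>) \<beta>)"

lemma moved_transpose: "a \<noteq> b \<Longrightarrow> {x. transpose a b x \<noteq> x} = {a, b}"
  by (auto simp: transpose_eq_iff)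

lemma factorization_entryE:
  assumes "\<rho> \<in> factorizations V m" "i \<in> {1..m}"
  obtains a b where "a \<in> V" "b \<in> V" "a \<noteq> b" "\<rho> i = transpose a b"
  using PiE_mem[OF assms(1)[unfolded factorizations_def] assms(2)] by blast

lemma graph_of_bij: "bij_betw (graph_of m) (factorizations V m) (e_graphs V m)"
proof (rule bij_betw_imageI)
  show "inj_on (graph_of m) (factorizations V m)"
  proof (rule inj_onI)
    fix \<rho> \<rho>' assume \<rho>: "\<rho> \<in> factorizations V m" and \<rho>': "\<rho>' \<in> factorizations V m"
      and eq: "graph_of m \<rho> = graph_of m \<rho>'"
    show "\<rho> = \<rho>'"
    proof (rule PiE_ext)
      show "\<rho> \<in> {1..m} \<rightarrow>\<^sub>E {\<tau>. \<exists>a\<in>V. \<exists>b\<in>V. a \<noteq> b \<and> \<tau> = transpose a b}"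
        "\<rho>' \<in> {1..m} \<rightarrow>\<^sub>E {\<tau>. \<exists>a\<in>V. \<exists>b\<in>V. a \<noteq> b \<and> \<tau> = transpose a b}"
        using \<rho> \<rho>' by (auto simp: factorizations_def)
      fix i assume i: "i \<in> {1..m}"
      obtain a b where ab: "a \<noteq> b" "\<rho> i = transpose a b" using \<rho> i by (rule factorization_entryE)
      obtain c d where cd: "c \<noteq> d" "\<rho>' i = transpose c d" using \<rho>' i by (rule factorization_entryE)
      have "{a, b} = {c, d}"
        using fun_cong[OF eq, of i] i ab cd by (simp add: graph_of_def moved_transpose)
      then show "\<rho> i = \<rho>' i"
        unfolding ab(2) cd(2) by (metis doubleton_eq_iff transpose_commute)
    qed
  qed
  show "graph_of m ` factorizations V m = e_graphs V m"
  proof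
    show "graph_of m ` factorizations V m \<subseteq> e_graphs V m"
    proof
      fix \<Gamma> assume "\<Gamma> \<in> graph_of m ` factorizations V m"
      then obtain \<rho> where \<rho>: "\<rho> \<in> factorizations V m" and \<Gamma>: "\<Gamma> = graph_of m \<rho>" by blast
      have "{x. \<rho> i x \<noteq> x} \<subseteq> V \<and> card {x. \<rho> i x \<noteq> x} = 2" if i: "i \<in> {1..m}" for i
      proof -
        obtain a b where "a \<in> V" "b \<in> V" "a \<noteq> b" "\<rho> i = transpose a b"
          using \<rho> i by (rule factorization_entryE)
        then show ?thesis by (simp add: moved_transpose)
      qed
      then show "\<Gamma> \<in> e_graphs V m"
        unfolding \<Gamma> graph_of_def e_graphs_def by (intro restrict_PiE_iff[THEN iffD2]) blast
    qed
    show "e_graphs V m \<subseteq> graph_of m ` factorizations V m"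
    proof
      fix \<Gamma> assume \<Gamma>: "\<Gamma> \<in> e_graphs V m"
      have "\<exists>a b. a \<in> V \<and> b \<in> V \<and> a \<noteq> b \<and> \<Gamma> i = {a, b}" if "i \<in> {1..m}" for i
        using PiE_mem[OF \<Gamma>[unfolded e_graphs_def] that] by (auto simp: card_2_iff)
      then obtain a b where ab: "\<And>i. i \<in> {1..m} \<Longrightarrow> a i \<in> V \<and> b i \<in> V \<and> a i \<noteq> b i \<and> \<Gamma> i = {a i, b i}"
        by metis
      define \<rho> where "\<rho> = (\<lambda>i\<in>{1..m}. transpose (a i) (b i))"
      have "\<rho> \<in> factorizations V m"
        unfolding factorizations_def \<rho>_def
        by (intro restrict_PiE_iff[THEN iffD2] ballI CollectI) (use ab in blast)
      moreover have "graph_of m \<rho> = \<Gamma>"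
      proof
        fix i show "graph_of m \<rho> i = \<Gamma> i"
        proof (cases "i \<in> {1..m}")
          case True
          then show ?thesis using ab[OF True] by (simp add: graph_of_def \<rho>_def moved_transpose)
        next
          case False
          then show ?thesis
            using PiE_arb[OF \<Gamma>[unfolded e_graphs_def] False]
            by (simp only: graph_of_def restrict_apply if_False)
        qed
      qed
      ultimately show "\<Gamma> \<in> graph_of m ` factorizations V m" by blast
    qed
  qed
qed

lemma factorization_of_mem: "\<Gamma> \<in> e_graphs V m \<Longrightarrow> factorization_of V m \<Gamma> \<in> factorizations V m"
  unfolding factorization_of_def
  using graph_of_bij[of m V] by (metis bij_betw_def inv_into_into)

lemma transposition_conj:
  assumes "a \<in> V" "b \<in> V" "a \<noteq> b" "c \<in> V" "d \<in> V" "c \<noteq> d"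
  shows "\<exists>x\<in>V. \<exists>y\<in>V. x \<noteq> y \<and> transpose c d \<circ> (transpose a b \<circ> transpose c d) = transpose x y"
proof (intro bexI conjI)
  show "transpose c d \<circ> (transpose a b \<circ> transpose c d) =
      transpose (transpose c d a) (transpose c d b)"
    by (auto simp: fun_eq_iff transpose_def)
qed (use assms in \<open>auto simp: transpose_def\<close>)

lemma perm_inv_entry:
  assumes "\<rho> \<in> factorizations V m" "i \<in> {1..m}"
  shows "perm_inv (\<rho> i) = \<rho> i" "\<rho> i (\<rho> i x) = x"
  using assms by (auto elim!: factorization_entryE)

lemma letter_act_mem:
  assumes \<rho>: "\<rho> \<in> factorizations V m" and x: "x \<in> letters m"
  shows "letter_act \<rho> x \<in> factorizations V m"
proof -
  obtain i where i: "i \<in> {1..<m}" "x = Gen i \<or> x = GenInv i"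
    using x by (auto simp: letters_def)
  then have i': "i \<in> {1..m}" "i + 1 \<in> {1..m}" by auto
  obtain a b where ab: "a \<in> V" "b \<in> V" "a \<noteq> b" "\<rho> i = transpose a b"
    using \<rho> i'(1) by (rule factorization_entryE)
  obtain c d where cd: "c \<in> V" "d \<in> V" "c \<noteq> d" "\<rho> (i + 1) = transpose c d"
    using \<rho> i'(2) by (rule factorization_entryE)
  let ?T = "{\<tau>. \<exists>a\<in>V. \<exists>b\<in>V. a \<noteq> b \<and> \<tau> = transpose a b}"
  have upd: "\<rho>(i := \<tau>, i + 1 := \<tau>') \<in> factorizations V m" if "\<tau> \<in> ?T" "\<tau>' \<in> ?T" for \<tau> \<tau>'
    using \<rho> i' that unfolding factorizations_def
    by (auto simp: PiE_iff extensional_def)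
  have T: "\<rho> i \<in> ?T" "\<rho> (i + 1) \<in> ?T" using ab cd by auto
  have "\<rho> i \<cdot> \<rho> (i + 1) \<cdot> perm_inv (\<rho> i) \<in> ?T"
    "perm_inv (\<rho> (i + 1)) \<cdot> \<rho> i \<cdot> \<rho> (i + 1) \<in> ?T"
    using transposition_conj[of a V b c d] transposition_conj[of c V d a b] ab cd
    by (simp_all add: perm_mult_def)
  from i(2) upd[OF this(1) T(1)] upd[OF T(2) this(2)] show ?thesis
    by (elim disjE) simp_all
qed

lemma word_act_mem:
  "\<rho> \<in> factorizations V m \<Longrightarrow> w \<in> words m \<Longrightarrow> foldl letter_act \<rho> w \<in> factorizations V m"
  by (induction w arbitrary: \<rho>) (auto simp: letter_act_mem)

lemma word_act_cong:
  "braid_equiv m u v \<Longrightarrow> \<rho> \<in> factorizations V m \<Longrightarrow> foldl letter_act \<rho> u = foldl letter_act \<rho> v"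
proof (induction arbitrary: \<rho> rule: braid_equiv.induct)
  case (word_append u u' v v')
  then show ?case
    using word_act_mem[OF word_append.prems, of u'] braid_equiv_words[OF word_append.hyps(1)] by simp
next
  case (word_cancel x)
  then obtain i where i: "i \<in> {1..<m}" "x = Gen i \<or> x = GenInv i" by (auto simp: letters_def)
  then have i': "i \<in> {1..m}" "i + 1 \<in> {1..m}" by auto
  note inv = perm_inv_entry[OF word_cancel.prems i'(1)] perm_inv_entry[OF word_cancel.prems i'(2)]
  from i(2) show ?case
  proof
    assume x: "x = Gen i"
    show ?thesis unfolding x
      using inv by (auto simp: fun_eq_iff perm_mult_def)
  next
    assume x: "x = GenInv i"
    have "perm_inv (\<rho> (i + 1)) = \<rho> (i + 1)" by (fact inv)
    then show ?thesis unfolding x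
      using inv by (auto simp: fun_eq_iff perm_mult_def)
  qed
next
  case (word_far i j)
  then have "i \<noteq> j" "i + 1 \<noteq> j" "j + 1 \<noteq> i" by auto
  then show ?case by (auto simp: fun_eq_iff)
next
  case (word_near i)
  then have i': "i \<in> {1..m}" "i + 1 \<in> {1..m}" "i + 2 \<in> {1..m}" by auto
  define a b c where abc: "a = \<rho> i" "b = \<rho> (Suc i)" "c = \<rho> (Suc (Suc i))"
  have aa: "\<And>x. a (a x) = x" and bb: "\<And>x. b (b x) = x" and ia: "perm_inv a = a" and ib: "perm_inv b = b"
    using perm_inv_entry[OF word_near.prems i'(1)] perm_inv_entry[OF word_near.prems i'(2)] by (simp_all add: abc)
  have iab: "perm_inv (a \<circ> (b \<circ> a)) = a \<circ> (b \<circ> a)"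
    by (rule inv_equality) (simp_all add: aa bb)
  have "foldl letter_act \<rho> [Gen i, Gen (i + 1), Gen i] k =
      foldl letter_act \<rho> [Gen (i + 1), Gen i, Gen (i + 1)] k" for k
    by (simp add: abc[symmetric] perm_mult_def ia ib iab) (simp add: fun_eq_iff aa bb)
  then show ?case by (rule ext)
qed auto

lemma hurwitz_fact_class:
  assumes "\<rho> \<in> factorizations V m" "w \<in> words m"
  shows "hurwitz_fact \<rho> (braid_class m w) = foldl letter_act \<rho> w"
proof -
  have "braid_equiv m w (SOME v. v \<in> braid_class m w)"
    using assms(2) by (metis mem_braid_class braid_equiv.word_refl someI)
  then show ?thesis
    unfolding hurwitz_fact_def using word_act_cong assms(1) by metis
qed

lemma hurwitz_fact_mem:
  "\<rho> \<in> factorizations V m \<Longrightarrow> \<beta> \<in> carrier (braid_group m) \<Longrightarrow>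
    hurwitz_fact \<rho> \<beta> \<in> factorizations V m"
  by (metis braid_carrierE hurwitz_fact_class word_act_mem)

lemma hurwitz_fact_one: "\<rho> \<in> factorizations V m \<Longrightarrow> hurwitz_fact \<rho> \<one>\<^bsub>braid_group m\<^esub> = \<rho>"
  using hurwitz_fact_class[of \<rho> V m "[]"] by (simp add: braid_one)

lemma hurwitz_fact_mult:
  assumes "\<rho> \<in> factorizations V m" "\<beta> \<in> carrier (braid_group m)" "\<gamma> \<in> carrier (braid_group m)"
  shows "hurwitz_fact \<rho> (\<beta> \<otimes>\<^bsub>braid_group m\<^esub> \<gamma>) = hurwitz_fact (hurwitz_fact \<rho> \<beta>) \<gamma>"
proof -
  obtain u v where "u \<in> words m" "\<beta> = braid_class m u"
    "v \<in> words m" "\<gamma> = braid_class m v" using assms by (auto elim!: braid_carrierE)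
  with assms(1) show ?thesis
    using hurwitz_fact_class[of \<rho> V m u] hurwitz_fact_class[of \<rho> V m "u @ v"]
      hurwitz_fact_class[of "foldl letter_act \<rho> u" V m v] word_act_mem[of \<rho> V m u]
    by (simp add: braid_mult)
qed

lemma hurwitz_fact_sigma:
  assumes "\<rho> \<in> factorizations V m" "i \<in> {1..<m}"
  shows "hurwitz_fact \<rho> (sigma m i) =
    \<rho>(i := \<rho> i \<cdot> \<rho> (i + 1) \<cdot> perm_inv (\<rho> i), i + 1 := \<rho> i)"
  using hurwitz_fact_class[OF assms(1), of "[Gen i]"] assms(2) by (simp add: sigma_def)

lemma hurwitz_mem:
  "\<Gamma> \<in> e_graphs V m \<Longrightarrow> \<beta> \<in> carrier (braid_group m) \<Longrightarrow> hurwitz V m \<Gamma> \<beta> \<in> e_graphs V m"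
  unfolding hurwitz_def
  using hurwitz_fact_mem[OF factorization_of_mem] bij_betw_apply[OF graph_of_bij] by metis


section \<open>The mind-body dual\<close>

text \<open>\<open>trail_steps m \<Gamma> e w\<close> is the continuation of a greedy trail that has reached \<open>w\<close>
  along the edge \<open>e\<close> (or starts at \<open>w\<close>, if \<open>e = 0\<close>): the list of the edges still to be
  traversed, each paired with the vertex it leads to.\<close>

function trail_steps :: "nat \<Rightarrow> (nat \<Rightarrow> 'v set) \<Rightarrow> nat \<Rightarrow> 'v \<Rightarrow> (nat \<times> 'v) list" where
  "trail_steps m \<Gamma> e w =
    (if \<exists>j\<in>{e<..m}. w \<in> \<Gamma> j
     then let j = Min {j \<in> {e<..m}. w \<in> \<Gamma> j}; u = (THE u. \<Gamma> j = {w, u})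
          in (j, u) # trail_steps m \<Gamma> j u
     else [])"
  by pat_completeness auto
termination
proof (relation "measure (\<lambda>(m, \<Gamma>, e, w). m - e)")
  fix m e j and \<Gamma> :: "nat \<Rightarrow> 'v set" and w u
  assume ex: "\<exists>j\<in>{e<..m}. w \<in> \<Gamma> j" and j: "j = Min {j \<in> {e<..m}. w \<in> \<Gamma> j}"
  have "j \<in> {j \<in> {e<..m}. w \<in> \<Gamma> j}"
    unfolding j using ex by (intro Min_in) auto
  then show "((m, \<Gamma>, j, u), m, \<Gamma>, e, w) \<in> measure (\<lambda>(m, \<Gamma>, e, w). m - e)" by auto
qed simp

declare trail_steps.simps [simp del]

definition migt :: "nat \<Rightarrow> (nat \<Rightarrow> 'v set) \<Rightarrow> 'v \<Rightarrow> 'v \<times> (nat \<times> 'v) list" where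
  "migt m \<Gamma> v = (v, trail_steps m \<Gamma> 0 v)"

definition trail_edges :: "'v \<times> (nat \<times> 'v) list \<Rightarrow> nat set" where
  "trail_edges t = fst ` set (snd t)"

text \<open>The vertex \<open>migt m \<Gamma> v\<close> of the dual is identified with \<open>v\<close>.\<close>

definition dual :: "'v set \<Rightarrow> nat \<Rightarrow> (nat \<Rightarrow> 'v set) \<Rightarrow> nat \<Rightarrow> 'v set" where
  "dual V m \<Gamma> = (\<lambda>i\<in>{1..m}. {v \<in> V. i \<in> trail_edges (migt m \<Gamma> v)})"

lemma trail_steps_Suc_in:
  assumes "Suc e \<le> m" "w \<in> \<Gamma> (Suc e)"
  shows "trail_steps m \<Gamma> e w =
    (let u = (THE u. \<Gamma> (Suc e) = {w, u}) in (Suc e, u) # trail_steps m \<Gamma> (Suc e) u)"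
proof -
  have "Min {j \<in> {e<..m}. w \<in> \<Gamma> j} = Suc e"
    using assms by (intro Min_eqI) auto
  moreover have "\<exists>j\<in>{e<..m}. w \<in> \<Gamma> j" using assms by auto
  ultimately show ?thesis by (subst trail_steps.simps) (simp add: Let_def)
qed

lemma trail_steps_Suc_notin:
  assumes "w \<notin> \<Gamma> (Suc e)"
  shows "trail_steps m \<Gamma> e w = trail_steps m \<Gamma> (Suc e) w"
proof -
  have "e < j \<longleftrightarrow> Suc e < j" if "w \<in> \<Gamma> j" for j
    using assms that by (cases "j = Suc e") auto
  then have "{j \<in> {e<..m}. w \<in> \<Gamma> j} = {j \<in> {Suc e<..m}. w \<in> \<Gamma> j}"
    by auto
  moreover from this have "(\<exists>j\<in>{e<..m}. w \<in> \<Gamma> j) \<longleftrightarrow> (\<exists>j\<in>{Suc e<..m}. w \<in> \<Gamma> j)" by blast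
  ultimately show ?thesis
    by (simp add: trail_steps.simps[of m \<Gamma> e w] trail_steps.simps[of m \<Gamma> "Suc e" w])
qed

lemma trail_steps_gt: "(j, u) \<in> set (trail_steps m \<Gamma> e w) \<Longrightarrow> e < j"
proof (induction m \<Gamma> e w rule: trail_steps.induct)
  case (1 m \<Gamma> e w)
  show ?case
  proof (cases "\<exists>j\<in>{e<..m}. w \<in> \<Gamma> j")
    case True
    define k where "k = Min {j \<in> {e<..m}. w \<in> \<Gamma> j}"
    have "k \<in> {j \<in> {e<..m}. w \<in> \<Gamma> j}" unfolding k_def using True by (intro Min_in) auto
    then have "e < k" by simp
    moreover have "trail_steps m \<Gamma> e w =
        (k, THE u. \<Gamma> k = {w, u}) # trail_steps m \<Gamma> k (THE u. \<Gamma> k = {w, u})"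
      by (subst trail_steps.simps) (simp only: True if_True Let_def k_def)
    ultimately show ?thesis
      using "1.prems" "1.IH"[OF True k_def refl] by auto
  next
    case False
    then show ?thesis using "1.prems" by (subst (asm) trail_steps.simps) auto
  qed
qed

lemma card_trails_through_edge:
  assumes \<Gamma>: "\<Gamma> \<in> e_graphs V m"
  shows "e < i \<Longrightarrow> i \<le> m \<Longrightarrow> card {v \<in> V. i \<in> fst ` set (trail_steps m \<Gamma> e v)} = 2"
proof (induction "i - e" arbitrary: e)
  case 0
  then show ?case by simp
next
  case (Suc n)
  have "\<Gamma> (Suc e) \<subseteq> V" "card (\<Gamma> (Suc e)) = 2"
    using PiE_mem[OF \<Gamma>[unfolded e_graphs_def], of "Suc e"] Suc.prems by auto
  then obtain a b where ab: "\<Gamma> (Suc e) = {a, b}" "a \<noteq> b" "a \<in> V" "b \<in> V"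
    by (auto simp: card_2_iff)
  have le: "Suc e \<le> m" using Suc.prems by simp
  have a: "(THE u. \<Gamma> (Suc e) = {a, u}) = b" and b: "(THE u. \<Gamma> (Suc e) = {b, u}) = a"
    using ab by (auto intro!: the_equality simp: doubleton_eq_iff)
  have sa: "trail_steps m \<Gamma> e a = (Suc e, b) # trail_steps m \<Gamma> (Suc e) b"
    and sb: "trail_steps m \<Gamma> e b = (Suc e, a) # trail_steps m \<Gamma> (Suc e) a"
    using trail_steps_Suc_in[OF le, of a \<Gamma>] trail_steps_Suc_in[OF le, of b \<Gamma>] ab a b
    by (simp_all add: Let_def)
  have so: "trail_steps m \<Gamma> e v = trail_steps m \<Gamma> (Suc e) v" if "v \<noteq> a" "v \<noteq> b" for v
    using trail_steps_Suc_notin[of v \<Gamma> e m] that ab by simp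
  show ?case
  proof (cases "i = Suc e")
    case True
    have "{v \<in> V. i \<in> fst ` set (trail_steps m \<Gamma> e v)} = {a, b}"
    proof -
      have "i \<notin> fst ` set (trail_steps m \<Gamma> (Suc e) v)" for v
        using trail_steps_gt[of i _ m \<Gamma> "Suc e" v] True by auto
      then have "v \<in> {a, b}" if "i \<in> fst ` set (trail_steps m \<Gamma> e v)" for v
        using that so[of v] by (metis insert_iff)
      moreover have "i \<in> fst ` set (trail_steps m \<Gamma> e a)" "i \<in> fst ` set (trail_steps m \<Gamma> e b)"
        using sa sb True by simp_all
      ultimately show ?thesis using ab by blast
    qed
    then show ?thesis using ab by simp
  next
    case False
    let ?S = "{v \<in> V. i \<in> fst ` set (trail_steps m \<Gamma> (Suc e) v)}"
    have "i \<in> fst ` set (trail_steps m \<Gamma> e v) \<longleftrightarrow>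
        i \<in> fst ` set (trail_steps m \<Gamma> (Suc e) (transpose a b v))" for v
      using sa sb so[of v] False by (auto simp: transpose_def)
    moreover have "transpose a b v \<in> V \<longleftrightarrow> v \<in> V" for v
      using ab by (auto simp: transpose_def)
    ultimately have "{v \<in> V. i \<in> fst ` set (trail_steps m \<Gamma> e v)} = {v. transpose a b v \<in> ?S}"
      by simp
    also have "\<dots> = transpose a b ` ?S"
    proof (intro equalityI subsetI)
      fix v assume "v \<in> {v. transpose a b v \<in> ?S}"
      then show "v \<in> transpose a b ` ?S"
        by (intro image_eqI[of v _ "transpose a b v"]) simp_all
    qed auto
    also have "card \<dots> = card ?S"
      by (rule card_image, rule inj_on_inverseI[of _ "transpose a b"]) simp
    also have "\<dots> = 2"
      using Suc False by (intro Suc.hyps) auto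
    finally show ?thesis .
  qed
qed

lemma dual_mem: "\<Gamma> \<in> e_graphs V m \<Longrightarrow> dual V m \<Gamma> \<in> e_graphs V m"
  using card_trails_through_edge[of \<Gamma> V m 0]
  by (auto simp: e_graphs_def dual_def migt_def trail_edges_def)

end

theory Submission
  imports Defs
begin

text \<open>Write the e-graph as a factorization \<open>\<rho> = (\<tau>\<^sub>1, \<dots>, \<tau>\<^sub>m)\<close>. A greedy trail scans the edges in
  increasing order, and an edge that contains its current vertex moves it to the other endpoint,
  so each scanned edge acts by its transposition. The trail from \<open>v\<close> has therefore reached the
  image of \<open>v\<close> under \<open>\<pi>\<^sub>k = \<tau>\<^sub>1 \<dots> \<tau>\<^sub>k\<close> after the edges up to \<open>k\<close>, and it uses the edge \<open>i\<close> iff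
  \<open>\<tau>\<^sub>i\<close> moves the image of \<open>v\<close> under \<open>\<pi>\<^sub>i\<^sub>-\<^sub>1\<close>. Hence the mind-body dual corresponds to the algebraic
  operation \<open>\<tau>\<^sub>i\<^sup>* = \<pi>\<^sub>i\<^sub>-\<^sub>1 \<tau>\<^sub>i \<pi>\<^sub>i\<^sub>-\<^sub>1\<^sup>-\<^sup>1\<close> on factorizations (\<open>dual_graph_of\<close>).

  For this operation the theorem is a computation. The generator \<open>\<sigma>\<^sub>i\<close> replaces the pair
  \<open>(\<tau>\<^sub>i, \<tau>\<^sub>i\<^sub>+\<^sub>1)\<close> by one with the same product, so \<open>\<pi>\<^sub>i\<close> is the only partial product that can change
  and only the entries \<open>i\<close> and \<open>i + 1\<close> of the dual are affected. The new dual entry \<open>i\<close> is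
  \<open>\<pi>\<^sub>i\<^sub>-\<^sub>1 \<tau>\<^sub>i \<tau>\<^sub>i\<^sub>+\<^sub>1 \<tau>\<^sub>i \<pi>\<^sub>i\<^sub>-\<^sub>1\<^sup>-\<^sup>1\<close>, which is the old dual entry \<open>i + 1\<close>; the new entry \<open>i + 1\<close> is then the
  old dual entry \<open>i\<close> conjugated by the old dual entry \<open>i + 1\<close>, so the dual changes as under \<open>\<sigma>\<^sub>i\<^sup>-\<^sup>1\<close>
  (\<open>dual_fact_Gen\<close>). The case of \<open>\<sigma>\<^sub>i\<^sup>-\<^sup>1\<close> follows by inverting that of \<open>\<sigma>\<^sub>i\<close>, and the general case
  by induction over a word that represents the braid.\<close>

section \<open>The dual of a factorization\<close>

fun partial_product :: "(nat \<Rightarrow> 'v \<Rightarrow> 'v) \<Rightarrow> nat \<Rightarrow> 'v \<Rightarrow> 'v" where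
  "partial_product \<rho> 0 = id"
| "partial_product \<rho> (Suc k) = partial_product \<rho> k \<cdot> \<rho> (Suc k)"

definition dual_fact :: "nat \<Rightarrow> (nat \<Rightarrow> 'v \<Rightarrow> 'v) \<Rightarrow> nat \<Rightarrow> 'v \<Rightarrow> 'v" where
  "dual_fact m \<rho> = (\<lambda>i\<in>{1..m}.
    partial_product \<rho> (i - 1) \<cdot> \<rho> i \<cdot> perm_inv (partial_product \<rho> (i - 1)))"

lemma partial_product_pos:
  "0 < k \<Longrightarrow> partial_product \<rho> k = \<rho> k \<circ> partial_product \<rho> (k - 1)"
  by (cases k) (simp_all add: perm_mult_def)

lemma dual_fact_apply:
  "i \<in> {1..m} \<Longrightarrow> dual_fact m \<rho> i =
    perm_inv (partial_product \<rho> (i - 1)) \<circ> \<rho> i \<circ> partial_product \<rho> (i - 1)"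
  by (simp add: dual_fact_def perm_mult_def o_assoc)

lemma entry_in_V_iff:
  assumes "\<rho> \<in> factorizations V m" "i \<in> {1..m}"
  shows "\<rho> i x \<in> V \<longleftrightarrow> x \<in> V"
  using assms by (auto elim!: factorization_entryE simp: transpose_def split: if_splits)

lemma partial_product_in_V_iff:
  "\<rho> \<in> factorizations V m \<Longrightarrow> k \<le> m \<Longrightarrow> partial_product \<rho> k x \<in> V \<longleftrightarrow> x \<in> V"
  by (induction k) (auto simp: perm_mult_def entry_in_V_iff)

lemma bij_partial_product:
  "\<rho> \<in> factorizations V m \<Longrightarrow> k \<le> m \<Longrightarrow> bij (partial_product \<rho> k)"
proof (induction k)
  case (Suc k)
  have "bij (\<rho> (Suc k))"
    using Suc.prems perm_inv_entry(2)[OF Suc.prems(1), of "Suc k"]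
    by (intro involuntory_imp_bij) auto
  moreover have "bij (partial_product \<rho> k)" using Suc by simp
  ultimately show ?case
    unfolding partial_product.simps perm_mult_def by (rule bij_comp[rotated])
qed simp

text \<open>Conjugating \<open>(a b)\<close> by a partial product \<open>\<pi>\<close> gives the transposition of the preimages of \<open>a\<close>
  and \<open>b\<close> under \<open>\<pi>\<close>, and these lie in \<open>V\<close> because \<open>\<pi>\<close> preserves \<open>V\<close>.\<close>

lemma dual_fact_mem:
  assumes \<rho>: "\<rho> \<in> factorizations V m"
  shows "dual_fact m \<rho> \<in> factorizations V m"
  unfolding factorizations_def dual_fact_def
proof (intro restrict_PiE_iff[THEN iffD2] ballI CollectI)
  fix i assume i: "i \<in> {1..m}"
  obtain a b where ab: "a \<in> V" "b \<in> V" "a \<noteq> b" "\<rho> i = transpose a b"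
    using \<rho> i by (rule factorization_entryE)
  let ?P = "partial_product \<rho> (i - 1)"
  have le: "i - 1 \<le> m" using i by auto
  have bij: "bij ?P" using bij_partial_product[OF \<rho> le] .
  define a' b' where "a' = perm_inv ?P a" and "b' = perm_inv ?P b"
  have P: "?P a' = a" "?P b' = b"
    using bij by (simp_all add: a'_def b'_def bij_is_surj surj_f_inv_f)
  then have V: "a' \<in> V" "b' \<in> V" "a' \<noteq> b'"
    using partial_product_in_V_iff[OF \<rho> le, of a'] partial_product_in_V_iff[OF \<rho> le, of b'] ab
    by auto
  have "perm_inv ?P (transpose a b (?P x)) = transpose a' b' x" for x
  proof -
    have "transpose a b (?P x) = ?P (transpose a' b' x)"
      using bij_is_inj[OF bij] by (auto simp: transpose_def P[symmetric] inj_eq)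
    then show ?thesis using bij by (simp add: bij_is_inj)
  qed
  then show "\<exists>a\<in>V. \<exists>b\<in>V. a \<noteq> b \<and> ?P \<cdot> \<rho> i \<cdot> perm_inv ?P = transpose a b"
    using V ab(4) by (intro bexI[of _ a'] bexI[of _ b']) (auto simp: perm_mult_def fun_eq_iff)
qed


section \<open>The dual in terms of partial products\<close>

text \<open>A trail that stands at \<open>w\<close> before the edge \<open>Suc e\<close> is examined stands at \<open>\<rho> (Suc e) w\<close>
  afterwards, whether or not it takes that edge.\<close>

lemma trail_steps_Suc:
  assumes \<rho>: "\<rho> \<in> factorizations V m" and le: "Suc e \<le> m"
  defines "\<Gamma> \<equiv> graph_of m \<rho>"
  shows "fst ` set (trail_steps m \<Gamma> e w) =
    (if w \<in> \<Gamma> (Suc e) then {Suc e} else {}) \<union>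
    fst ` set (trail_steps m \<Gamma> (Suc e) (\<rho> (Suc e) w))"
proof -
  have in_range: "Suc e \<in> {1..m}" using le by simp
  obtain a b where ab: "a \<noteq> b" "\<rho> (Suc e) = transpose a b"
    using \<rho> in_range by (rule factorization_entryE)
  then have edge: "\<Gamma> (Suc e) = {a, b}"
    using in_range by (simp add: \<Gamma>_def graph_of_def moved_transpose)
  show ?thesis
  proof (cases "w \<in> \<Gamma> (Suc e)")
    case True
    have "(THE u. \<Gamma> (Suc e) = {w, u}) = \<rho> (Suc e) w"
      using True edge ab by (auto intro!: the_equality simp: doubleton_eq_iff)
    then show ?thesis
      using True trail_steps_Suc_in[of e m w \<Gamma>] le by (simp add: Let_def)
  next
    case False
    then have "\<rho> (Suc e) w = w" using edge ab by (auto simp: transpose_def)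
    then show ?thesis using False trail_steps_Suc_notin[of w \<Gamma> e m] by simp
  qed
qed

text \<open>A greedy trail that starts at \<open>v\<close> stands at \<open>partial_product \<rho> e v\<close> once the edges up to \<open>e\<close>
  have been examined. The statement starts from an arbitrary \<open>e\<close> so that the induction can
  advance one edge at a time; migts are the case \<open>e = 0\<close>.\<close>

lemma trail_uses_edge_iff:
  assumes \<rho>: "\<rho> \<in> factorizations V m"
  shows "e < i \<Longrightarrow> i \<le> m \<Longrightarrow>
    i \<in> fst ` set (trail_steps m (graph_of m \<rho>) e (partial_product \<rho> e v)) \<longleftrightarrow>
    partial_product \<rho> (i - 1) v \<in> graph_of m \<rho> i"
proof (induction "i - e" arbitrary: e)
  case 0
  then show ?case by simp
next
  case (Suc n)
  let ?T = "\<lambda>e w. fst ` set (trail_steps m (graph_of m \<rho>) e w)"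
  have step: "?T e (partial_product \<rho> e v) =
      (if partial_product \<rho> e v \<in> graph_of m \<rho> (Suc e) then {Suc e} else {}) \<union>
      ?T (Suc e) (partial_product \<rho> (Suc e) v)"
    using trail_steps_Suc[OF \<rho>, of e] Suc.prems by (simp add: perm_mult_def)
  show ?case
  proof (cases "i = Suc e")
    case True
    have "i \<notin> ?T (Suc e) w" for w
      using trail_steps_gt[of i _ m "graph_of m \<rho>" "Suc e" w] True by auto
    then show ?thesis using step True by simp
  next
    case False
    then show ?thesis using step Suc.hyps(1)[of "Suc e"] Suc.hyps(2) Suc.prems by auto
  qed
qed

text \<open>The points moved by \<open>\<pi> \<tau> \<pi>\<^sup>-\<^sup>1\<close> are the preimages under \<open>\<pi>\<close> of those moved by \<open>\<tau>\<close>.\<close>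

lemma dual_graph_of:
  assumes \<rho>: "\<rho> \<in> factorizations V m"
  shows "dual V m (graph_of m \<rho>) = graph_of m (dual_fact m \<rho>)"
proof
  fix i show "dual V m (graph_of m \<rho>) i = graph_of m (dual_fact m \<rho>) i"
  proof (cases "i \<in> {1..m}")
    case True
    let ?P = "partial_product \<rho> (i - 1)"
    have le: "i - 1 \<le> m" using True by auto
    have "graph_of m \<rho> i \<subseteq> V"
      using True \<rho> by (auto elim!: factorization_entryE simp: graph_of_def transpose_def
          split: if_splits)
    then have "v \<in> V" if "?P v \<in> graph_of m \<rho> i" for v
      using that partial_product_in_V_iff[OF \<rho> le] by blast
    then have "dual V m (graph_of m \<rho>) i = {v. ?P v \<in> graph_of m \<rho> i}"
      using True trail_uses_edge_iff[OF \<rho>, of 0 i]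
      by (auto simp: dual_def migt_def trail_edges_def)
    also have "\<dots> = {v. \<rho> i (?P v) \<noteq> ?P v}"
      using True by (simp add: graph_of_def)
    also have "\<dots> = {v. perm_inv ?P (\<rho> i (?P v)) \<noteq> v}"
      using bij_inv_eq_iff[OF bij_partial_product[OF \<rho> le]] by metis
    finally show ?thesis
      using True by (simp add: graph_of_def dual_fact_def perm_mult_def)
  qed (auto simp: dual_def graph_of_def)
qed


section \<open>The dual and the generators\<close>

lemma partial_product_cong:
  "(\<And>j. j \<in> {1..k} \<Longrightarrow> \<rho> j = \<rho>' j) \<Longrightarrow> partial_product \<rho> k = partial_product \<rho>' k"
  by (induction k) auto

text \<open>The first \<open>i + 1\<close> entries keep their product because \<open>(\<tau>\<^sub>i \<tau>\<^sub>i\<^sub>+\<^sub>1 \<tau>\<^sub>i\<^sup>-\<^sup>1) \<tau>\<^sub>i = \<tau>\<^sub>i \<tau>\<^sub>i\<^sub>+\<^sub>1\<close>, and the other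
  entries do not change.\<close>

lemma partial_product_Gen:
  assumes \<rho>: "\<rho> \<in> factorizations V m" and i: "i \<in> {1..<m}" and k: "k \<noteq> i"
  shows "partial_product (letter_act \<rho> (Gen i)) k = partial_product \<rho> k"
proof (cases "k < i")
  case True
  then show ?thesis by (intro partial_product_cong) auto
next
  case False
  have pos: "0 < i" using i by simp
  have invol: "perm_inv (\<rho> i) = \<rho> i" "\<And>x. \<rho> i (\<rho> i x) = x"
    using perm_inv_entry[OF \<rho>, of i] i by auto
  let ?\<rho>' = "letter_act \<rho> (Gen i)"
  have "Suc i \<le> k" using False k by simp
  then show ?thesis
  proof (induction k rule: dec_induct)
    case base
    have "partial_product ?\<rho>' (i - 1) = partial_product \<rho> (i - 1)"
      using pos by (intro partial_product_cong) auto
    then have "partial_product ?\<rho>' (Suc i) =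
        \<rho> i \<circ> (\<rho> i \<circ> (\<rho> (Suc i) \<circ> \<rho> i)) \<circ> partial_product \<rho> (i - 1)"
      by (simp only: partial_product.simps(2) partial_product_pos[OF pos])
        (simp add: perm_mult_def invol(1) o_assoc)
    also have "\<dots> = partial_product \<rho> (Suc i)"
      by (simp only: partial_product.simps(2) partial_product_pos[OF pos])
        (simp add: perm_mult_def fun_eq_iff invol(2))
    finally show ?case .
  next
    case (step k)
    then show ?case by simp
  qed
qed

text \<open>Let \<open>a = \<tau>\<^sub>i\<close>, \<open>b = \<tau>\<^sub>i\<^sub>+\<^sub>1\<close> and \<open>\<pi> = \<pi>\<^sub>i\<^sub>-\<^sub>1\<close>. The dual entries \<open>i\<close> and \<open>i + 1\<close> are
  \<open>x = \<pi> a \<pi>\<^sup>-\<^sup>1\<close> and \<open>y = (\<pi> a) b (\<pi> a)\<^sup>-\<^sup>1 = \<pi> (a b a) \<pi>\<^sup>-\<^sup>1\<close>. Applying \<open>\<sigma>\<^sub>i\<close> to \<open>\<rho>\<close> replaces \<open>(a, b)\<close> by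
  \<open>(a b a, a)\<close>, so the dual entries become \<open>\<pi> (a b a) \<pi>\<^sup>-\<^sup>1 = y\<close> and
  \<open>\<pi> (a b a) a (a b a)\<^sup>-\<^sup>1 \<pi>\<^sup>-\<^sup>1 = y x y\<^sup>-\<^sup>1\<close>, which equals \<open>y\<^sup>-\<^sup>1 x y\<close> because \<open>y\<close> is an involution.\<close>

lemma dual_fact_Gen:
  assumes \<rho>: "\<rho> \<in> factorizations V m" and i: "i \<in> {1..<m}"
  shows "dual_fact m (letter_act \<rho> (Gen i)) = letter_act (dual_fact m \<rho>) (GenInv i)"
proof
  fix k
  have pos: "0 < i" using i by simp
  have i': "i \<in> {1..m}" "i + 1 \<in> {1..m}" using i by auto
  define a b P where "a = \<rho> i" and "b = \<rho> (i + 1)" and "P = partial_product \<rho> (i - 1)"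
  let ?\<rho>' = "letter_act \<rho> (Gen i)"
  have aa: "a (a x) = x" and bb: "b (b x) = x"
    and inv_a: "perm_inv a = a" and inv_b: "perm_inv b = b" for x
    using perm_inv_entry[OF \<rho> i'(1)] perm_inv_entry[OF \<rho> i'(2)] by (simp_all add: a_def b_def)
  have bij_a: "bij a" and bij_b: "bij b"
    using aa bb by (auto intro: involuntory_imp_bij)
  have bij_P: "bij P"
    unfolding P_def using bij_partial_product[OF \<rho>, of "i - 1"] i by force
  have P_inv: "P (perm_inv P x) = x" for x
    using bij_P by (simp add: bij_is_surj surj_f_inv_f)
  have P': "partial_product ?\<rho>' (i - 1) = P"
    unfolding P_def using partial_product_Gen[OF \<rho> i, of "i - 1"] pos by simp
  have \<rho>'_i: "?\<rho>' i = a \<circ> b \<circ> a" and \<rho>'_Suc_i: "?\<rho>' (i + 1) = a"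
    by (simp_all add: perm_mult_def a_def[symmetric] b_def[symmetric, simplified] inv_a o_assoc)
  have dual_i: "dual_fact m \<rho> i = perm_inv P \<circ> a \<circ> P"
    unfolding dual_fact_apply[OF i'(1)] a_def P_def ..
  \<comment> \<open>\<open>\<circ>\<close> composes from right to left, so the products of the text appear in reverse order.\<close>
  have "partial_product \<rho> (i + 1 - 1) = a \<circ> P"
    using partial_product_pos[OF pos, of \<rho>] by (simp add: a_def P_def)
  moreover have "perm_inv (a \<circ> P) = perm_inv P \<circ> a"
    using o_inv_distrib[OF bij_a bij_P] inv_a by simp
  ultimately have dual_Suc_i: "dual_fact m \<rho> (i + 1) = perm_inv P \<circ> a \<circ> b \<circ> a \<circ> P"
    unfolding dual_fact_apply[OF i'(2)] b_def[symmetric] by (simp only: o_assoc)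
  consider "k = i" | "k = i + 1" | "k \<notin> {i, i + 1}" by blast
  then show "dual_fact m ?\<rho>' k = letter_act (dual_fact m \<rho>) (GenInv i) k"
  proof cases
    case 1
    have "dual_fact m ?\<rho>' i = perm_inv P \<circ> (a \<circ> b \<circ> a) \<circ> P"
      unfolding dual_fact_apply[OF i'(1)] P' \<rho>'_i ..
    then show ?thesis using 1 dual_Suc_i by (simp add: o_assoc)
  next
    case 2
    have "partial_product ?\<rho>' (i + 1 - 1) = a \<circ> b \<circ> a \<circ> P"
      using partial_product_pos[OF pos, of ?\<rho>'] unfolding \<rho>'_i P' by simp
    then have "dual_fact m ?\<rho>' (i + 1) = perm_inv (a \<circ> b \<circ> a \<circ> P) \<circ> a \<circ> (a \<circ> b \<circ> a \<circ> P)"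
      unfolding dual_fact_apply[OF i'(2)] \<rho>'_Suc_i by (simp only:)
    also have "perm_inv (a \<circ> b \<circ> a \<circ> P) = perm_inv P \<circ> (a \<circ> b \<circ> a)"
      using bij_a bij_b bij_P by (simp add: o_inv_distrib bij_comp inv_a inv_b o_assoc)
    finally have lhs: "dual_fact m ?\<rho>' (i + 1) = perm_inv P \<circ> (a \<circ> b \<circ> a) \<circ> a \<circ> (a \<circ> b \<circ> a \<circ> P)" .
    have "perm_inv (dual_fact m \<rho> (i + 1)) = dual_fact m \<rho> (i + 1)"
      using perm_inv_entry(1)[OF dual_fact_mem[OF \<rho>] i'(2)] .
    then have "letter_act (dual_fact m \<rho>) (GenInv i) (i + 1) =
        dual_fact m \<rho> (i + 1) \<circ> dual_fact m \<rho> i \<circ> dual_fact m \<rho> (i + 1)"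
      by (simp add: perm_mult_def o_assoc)
    then show ?thesis
      unfolding 2 lhs dual_i dual_Suc_i by (simp add: fun_eq_iff aa P_inv)
  next
    case 3
    have "partial_product ?\<rho>' (k - 1) = partial_product \<rho> (k - 1)" if "k \<in> {1..m}"
      using partial_product_Gen[OF \<rho> i, of "k - 1"] 3 that by force
    then show ?thesis using 3 by (auto simp: dual_fact_def)
  qed
qed

lemma letter_act_flip:
  assumes "\<rho> \<in> factorizations V m" "x \<in> letters m"
  shows "letter_act (letter_act \<rho> x) (flip x) = \<rho>"
  using word_act_cong[OF braid_equiv.word_cancel[OF assms(2)] assms(1)] by simp

lemma dual_fact_letter:
  assumes \<rho>: "\<rho> \<in> factorizations V m" and x: "x \<in> letters m"
  shows "dual_fact m (letter_act \<rho> x) = letter_act (dual_fact m \<rho>) (flip x)"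
proof (cases x)
  case (Gen i)
  then show ?thesis using dual_fact_Gen[OF \<rho>, of i] x by simp
next
  case (GenInv i)
  let ?\<rho>' = "letter_act \<rho> x"
  have mem: "?\<rho>' \<in> factorizations V m" using \<rho> x by (rule letter_act_mem)
  have "dual_fact m \<rho> = dual_fact m (letter_act ?\<rho>' (Gen i))"
    using letter_act_flip[OF \<rho> x] GenInv by simp
  also have "\<dots> = letter_act (dual_fact m ?\<rho>') x"
    using dual_fact_Gen[OF mem, of i] GenInv x by simp
  finally show ?thesis
    using letter_act_flip[OF dual_fact_mem[OF mem] x] by simp
qed

lemma dual_fact_word:
  "\<rho> \<in> factorizations V m \<Longrightarrow> w \<in> words m \<Longrightarrow>
    dual_fact m (foldl letter_act \<rho> w) = foldl letter_act (dual_fact m \<rho>) (map flip w)"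
  by (induction w arbitrary: \<rho>) (auto simp: letter_act_mem dual_fact_letter)


section \<open>The dual and the Hurwitz action on e-graphs\<close>

lemma hurwitz_graph_of:
  assumes "\<rho> \<in> factorizations V m" "w \<in> words m"
  shows "hurwitz V m (graph_of m \<rho>) (braid_class m w) = graph_of m (foldl letter_act \<rho> w)"
proof -
  have "factorization_of V m (graph_of m \<rho>) = \<rho>"
    unfolding factorization_of_def
    using graph_of_bij[of m V] assms(1) by (simp add: bij_betw_def)
  then show ?thesis using hurwitz_fact_class[OF assms] by (simp add: hurwitz_def)
qed

theorem theorem3p10:
  fixes V :: "'v set" and m :: nat and \<Gamma> :: "nat \<Rightarrow> 'v set" and \<beta> :: "letter list set"
  assumes "finite V"
    and "\<Gamma> \<in> e_graphs V m"
    and "\<beta> \<in> carrier (braid_group m)"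
  shows "dual V m (hurwitz V m \<Gamma> \<beta>) = hurwitz V m (dual V m \<Gamma>) (braid_star m \<beta>)"
proof -
  obtain \<rho> where \<rho>: "\<rho> \<in> factorizations V m" and \<Gamma>: "\<Gamma> = graph_of m \<rho>"
    using assms(2) graph_of_bij[of m V] by (auto simp: bij_betw_def)
  obtain w where w: "w \<in> words m" and \<beta>: "\<beta> = braid_class m w"
    using assms(3) by (rule braid_carrierE)
  have flip_w: "map flip w \<in> words m" using w by simp
  have "dual V m (hurwitz V m \<Gamma> \<beta>) = graph_of m (dual_fact m (foldl letter_act \<rho> w))"
    unfolding \<Gamma> \<beta> hurwitz_graph_of[OF \<rho> w] by (rule dual_graph_of[OF word_act_mem[OF \<rho> w]])
  also have "\<dots> = graph_of m (foldl letter_act (dual_fact m \<rho>) (map flip w))"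
    by (simp only: dual_fact_word[OF \<rho> w])
  also have "\<dots> = hurwitz V m (dual V m \<Gamma>) (braid_star m \<beta>)"
    unfolding \<Gamma> \<beta> dual_graph_of[OF \<rho>] braid_star_class[OF w]
    by (rule hurwitz_graph_of[OF dual_fact_mem[OF \<rho>] flip_w, symmetric])
  finally show ?thesis .
qed

end
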